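(* Let $m$ be a nonzero integer, $m=\varepsilon p_1^{\alpha_1}p_2^{\alpha_2}\cdots p_r^{\alpha_r}$ with $\varepsilon=\pm1$, $p_1,\dots,p_r$ distinct positive primes and all $\alpha_i\ge 1$, and let $x$ be an integer. If $p_{i_1},\dots,p_{i_t}$ are all the distinct primes which divide $x$ and $m$ simultaneously, then $$(x+C_1)(x+C_2)\cdots(x+C_{\varphi(m)})\equiv \delta \pmod{p_{i_1}^{\alpha_{i_1}}p_{i_2}^{\alpha_{i_2}}\cdots p_{i_t}^{\alpha_{i_t}}},$$ where $\delta=-1$ if $m\in A$ and $\delta=+1$ if $m\notin A$.
   Context: $\varphi$ is Euler's totient function, with $\varphi(-k)=\varphi(k)$. For a nonzero integer $m$, $C_1,\dots,C_{\varphi(m)}$ denotes a reduced residue system modulo $m$ (representatives of all the residue classes modulo $m$ that are relatively prime to $m$). $A$ is the set of integers $m$ such that $m=\pm p^\beta$ or $m=\pm 2p^\beta$ with $p$ an odd prime and $\beta\ge1$, or $m=\pm 2^\alpha$ with $\alpha\in\{0,1,2\}$, or $m=0$. An empty product equals $1$. *)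

theory Defs
  imports "HOL-Number_Theory.Number_Theory"
begin

definition phi :: "int \<Rightarrow> nat" where
  "phi m = totient (nat \<bar>m\<bar>)"

text \<open>The family \<open>C 1, \<dots>, C (phi m)\<close> contains exactly one representative of each residue class
  modulo \<open>m\<close> that is coprime to \<open>m\<close>; the values of \<open>C\<close> at other indices are irrelevant.\<close>

definition reduced_residue_system :: "int \<Rightarrow> (nat \<Rightarrow> int) \<Rightarrow> bool" where
  "reduced_residue_system m C \<longleftrightarrow>
     (\<forall>i\<in>{1..phi m}. coprime (C i) m) \<and>
     (\<forall>i\<in>{1..phi m}. \<forall>j\<in>{1..phi m}. [C i = C j] (mod m) \<longrightarrow> i = j) \<and>
     (\<forall>a. coprime a m \<longrightarrow> (\<exists>i\<in>{1..phi m}. [a = C i] (mod m)))"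

definition set_A :: "int set" where
  "set_A = {m. (\<exists>p \<beta>. prime p \<and> odd p \<and> \<beta> \<ge> 1 \<and>
                   (m = p ^ \<beta> \<or> m = - (p ^ \<beta>) \<or> m = 2 * p ^ \<beta> \<or> m = - (2 * p ^ \<beta>)))
              \<or> (\<exists>\<alpha>\<in>{0, 1, 2::nat}. m = 2 ^ \<alpha> \<or> m = - (2 ^ \<alpha>))
              \<or> m = 0}"

end

theory Submission
  imports Defs
begin

text \<open>
  Let \<open>d\<close> be the modulus of the congruence. It is coprime to \<open>m / d\<close>, so the Chinese remainder
  theorem gives \<open>y\<close> with \<open>y \<equiv> x\<close> modulo \<open>d\<close> and \<open>y \<equiv> 0\<close> modulo \<open>m / d\<close>. Every prime factor of \<open>m\<close>
  divides \<open>y\<close>, hence the numbers \<open>y + C i\<close> again form a reduced residue system modulo \<open>m\<close>, and the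
  claim reduces to Gauss's generalization of Wilson's theorem.

  For the latter, let \<open>n > 2\<close> and let \<open>c\<close> be a unit modulo \<open>n\<close> that is not a square. Pairing \<open>a\<close>
  with \<open>c / a\<close> shows that the product of all units is \<open>c\<close> to the power \<open>\<phi>(n) / 2\<close>. If there is a
  primitive root, take it as \<open>c\<close> and get \<open>-1\<close>; otherwise the exponent of the unit group divides
  \<open>\<phi>(n) / 2\<close> and the product is \<open>1\<close>.
\<close>

section \<open>Pairing the units modulo \<open>n\<close>\<close>

lemma in_totatives_iff_less:
  assumes "n > 1"
  shows "a \<in> totatives n \<longleftrightarrow> a < n \<and> coprime a n"
  using assms totatives_less[of a n] by (auto simp: in_totatives_iff intro!: Nat.gr0I)

lemma square_pred_cong_1:
  fixes n :: nat
  assumes "n > 0"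
  shows "[(n - 1)\<^sup>2 = 1] (mod n)"
proof -
  have "int n dvd (int n - 1)\<^sup>2 - 1"
    by (simp add: power2_eq_square algebra_simps)
  then show ?thesis
    using assms by (simp add: cong_iff_dvd_diff of_nat_diff flip: cong_int_iff)
qed

text \<open>Strip off one pair \<open>{a, f a}\<close> at a time: it has two distinct elements, so
  it lowers the cardinality by 2 and contributes one factor \<open>c\<close>.\<close>

lemma prod_fixpoint_free_involution_cong:
  fixes n c :: nat
  assumes "finite S"
    and "\<And>a. a \<in> S \<Longrightarrow> f a \<in> S" "\<And>a. a \<in> S \<Longrightarrow> f (f a) = a"
    and "\<And>a. a \<in> S \<Longrightarrow> f a \<noteq> a" "\<And>a. a \<in> S \<Longrightarrow> [a * f a = c] (mod n)"
  shows "[\<Prod>S = c ^ (card S div 2)] (mod n)"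
  using assms
proof (induction S rule: finite_psubset_induct)
  case (psubset S)
  show ?case
  proof (cases "S = {}")
    case False
    then obtain a where a: "a \<in> S" by blast
    define T where "T = S - {a, f a}"
    have fa: "f a \<in> S" "f a \<noteq> a" "f (f a) = a"
      using psubset.prems a by auto
    have S: "S = insert a (insert (f a) T)" "a \<notin> insert (f a) T" "f a \<notin> T" "finite T"
      using a fa psubset.hyps by (auto simp: T_def)
    have "[\<Prod>T = c ^ (card T div 2)] (mod n)"
    proof (rule psubset.IH)
      show "T \<subset> S" using a by (auto simp: T_def)
      \<comment> \<open>As \<open>f\<close> is an involution, \<open>f b\<close> could lie in the
        removed pair only if \<open>b\<close> did.\<close>
      show "f b \<in> T" if "b \<in> T" for b
        using that psubset.prems(1,2) fa by (metis DiffD1 DiffD2 DiffI T_def insert_iff empty_iff)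
    qed (use psubset.prems in \<open>auto simp: T_def\<close>)
    moreover have "[a * f a = c] (mod n)"
      using psubset.prems a by blast
    ultimately have "[(a * f a) * \<Prod>T = c * c ^ (card T div 2)] (mod n)"
      by (rule cong_mult[rotated])
    moreover have "\<Prod>S = (a * f a) * \<Prod>T"
      using S by (simp add: mult.assoc)
    moreover have "card S = Suc (Suc (card T))"
      using S by simp
    ultimately show ?thesis by simp
  qed auto
qed

lemma prod_totatives_nonsquare:
  fixes n c :: nat
  assumes n: "n > 2" and c: "coprime c n"
    and nonsquare: "\<And>a. coprime a n \<Longrightarrow> [a\<^sup>2 \<noteq> c] (mod n)"
  shows "[\<Prod>(totatives n) = c ^ (totient n div 2)] (mod n)"
proof -
  \<comment> \<open>This is \<open>c / a\<close>: by Euler's theorem the power of \<open>a\<close>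
    is its inverse. Reducing modulo \<open>n\<close> lets \<open>f\<close> act on the
    representatives themselves.\<close>
  define f where "f a = (c * a ^ (totient n - 1)) mod n" for a
  have tot: "a \<in> totatives n \<longleftrightarrow> a < n \<and> coprime a n" for a
    using n by (intro in_totatives_iff_less) simp
  have f_cop: "coprime (f a) n" if "coprime a n" for a
    using that c n by (simp add: f_def coprime_commute[of _ n])
  have mult_f: "[a * f a = c] (mod n)" if a: "coprime a n" for a
  proof -
    have "totient n = Suc (totient n - 1)"
      using n by simp
    then have "a * (c * a ^ (totient n - 1)) = c * a ^ totient n"
      by (metis mult.left_commute power_Suc)
    moreover have "[c * a ^ totient n = c * 1] (mod n)"
      using euler_theorem[OF a] by (rule cong_scalar_left)
    ultimately show ?thesis
      unfolding f_def by (metis cong_def mod_mult_right_eq mult.right_neutral)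
  qed
  have "[\<Prod>(totatives n) = c ^ (card (totatives n) div 2)] (mod n)"
  proof (rule prod_fixpoint_free_involution_cong)
    fix a assume "a \<in> totatives n"
    then have a: "a < n" "coprime a n" by (auto simp: tot)
    show "f a \<in> totatives n"
      using n f_cop[OF a(2)] by (simp add: tot) (simp add: f_def)
    show "[a * f a = c] (mod n)"
      using a mult_f by blast
    show "f a \<noteq> a"
      using mult_f[OF a(2)] nonsquare[OF a(2)] by (metis power2_eq_square)
    \<comment> \<open>Both sides are congruent to \<open>c\<close>; cancelling the unit
      \<open>f a\<close> leaves two congruent numbers below \<open>n\<close>.\<close>
    have "[f a * f (f a) = f a * a] (mod n)"
      using mult_f[OF a(2)] mult_f[OF f_cop[OF a(2)]] by (metis cong_def mult.commute)
    then have "[f (f a) = a] (mod n)"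
      using f_cop[OF a(2)] by (simp add: cong_mult_lcancel_nat)
    then show "f (f a) = a"
      using a n by (intro cong_less_imp_eq_nat[of _ n]) (auto simp: f_def)
  qed auto
  then show ?thesis by (simp add: totient_def)
qed

text \<open>For \<open>n > 2\<close> the distinct units 1 and \<open>n - 1\<close> have the same
  square, so squaring is not injective on the finite set of units and therefore not
  surjective.\<close>

lemma ex_coprime_nonsquare:
  fixes n :: nat
  assumes n: "n > 2"
  obtains c where "coprime c n" "\<And>a. coprime a n \<Longrightarrow> [a\<^sup>2 \<noteq> c] (mod n)"
proof -
  let ?sq = "\<lambda>a. a\<^sup>2 mod n"
  have tot: "a \<in> totatives n \<longleftrightarrow> a < n \<and> coprime a n" for a
    using n by (intro in_totatives_iff_less) simp
  have "?sq (n - 1) = ?sq 1"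
    using square_pred_cong_1[of n] n by (simp add: cong_def)
  then have "\<not> inj_on ?sq (totatives n)"
    using n minus_one_in_totatives[of n] one_in_totatives[of n] inj_onD[of ?sq "totatives n" "n - 1" 1]
    by auto
  moreover have "?sq ` totatives n \<subseteq> totatives n"
    using n by (auto simp: tot)
  ultimately obtain c where c: "c \<in> totatives n" "c \<notin> ?sq ` totatives n"
    using finite_surj_inj[of "totatives n" ?sq] by auto
  have "[a\<^sup>2 \<noteq> c] (mod n)" if "coprime a n" for a
  proof
    assume "[a\<^sup>2 = c] (mod n)"
    then have "c = ?sq (a mod n)"
      using c(1) by (simp add: cong_def tot power_mod)
    moreover have "a mod n \<in> totatives n"
      using that n by (simp add: tot)
    ultimately show False using c(2) by blast
  qed
  with c that show ?thesis by (auto simp: tot)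
qed

text \<open>Write -1 as \<open>g ^ i\<close> with \<open>i < totient n\<close>. Squaring gives
  \<open>totient n dvd i * 2\<close>, and \<open>i\<close> is nonzero because -1 differs from 1
  modulo \<open>n\<close>; hence \<open>i * 2\<close> can only be \<open>totient n\<close>.\<close>

lemma primroot_power_half_totient:
  assumes n: "n > 2" and g: "residue_primroot n g"
  shows "[g ^ (totient n div 2) = n - 1] (mod n)"
proof -
  have ord: "ord n g = totient n" "coprime n g"
    using g by (auto simp: residue_primroot_def)
  have "n - 1 \<in> (\<lambda>i. g ^ i mod n) ` {..<totient n}"
    using residue_primroot_is_generator[of n g] n g minus_one_in_totatives[of n]
    by (simp add: bij_betw_def)
  then obtain i where i: "i < totient n" "n - 1 = g ^ i mod n" by blast
  then have gi: "[g ^ i = n - 1] (mod n)"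
    using n by (simp add: cong_def)
  have "[g ^ (i * 2) = 1] (mod n)"
    using n square_pred_cong_1[of n] cong_pow[OF gi, of 2] by (metis cong_trans power_mult order.strict_trans zero_less_numeral)
  then have "totient n dvd i * 2"
    using ord by (simp add: ord_divides ord_divides')
  moreover have "i \<noteq> 0"
    using i n by (intro notI) simp
  ultimately obtain k where "i * 2 = totient n * k" "k \<noteq> 0"
    by (metis dvdE mult_eq_0_iff zero_neq_numeral)
  moreover from this i have "totient n * k < totient n * 2" by linarith
  then have "k < 2" by simp
  ultimately have "i * 2 = totient n"
    using less_2_cases by fastforce
  then show ?thesis using gi by (metis nonzero_mult_div_cancel_right zero_neq_numeral)
qed

section \<open>The exponent of a non-cyclic unit group\<close>

lemma Carmichael_mult_coprime_dvd_half_totient: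
  assumes "coprime a b" "a > 2" "b > 2"
  shows "Carmichael (a * b) dvd totient (a * b) div 2"
proof -
  obtain k l where kl: "totient a = 2 * k" "totient b = 2 * l"
    using totient_even assms by (meson evenE)
  have "Carmichael a dvd 2 * k" "Carmichael b dvd 2 * l"
    using Carmichael_dvd_totient kl by metis+
  then have "Carmichael a dvd 2 * k * l" "Carmichael b dvd 2 * k * l"
    by (metis dvd_mult2 mult.assoc mult.commute)+
  then have "lcm (Carmichael a) (Carmichael b) dvd 2 * k * l"
    by (rule lcm_least)
  moreover have "totient (a * b) div 2 = 2 * k * l"
    using assms kl by (simp add: totient_mult_coprime)
  ultimately show ?thesis
    using assms by (simp add: Carmichael_mult_coprime)
qed

text \<open>A power of two outside \<open>cyclic_moduli\<close> is at least 8, where the Carmichael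
  function is half the totient. Otherwise split off an odd prime power: a cofactor 1 or 2 would make
  \<open>n\<close> cyclic, so both factors exceed 2 and both have even totient.\<close>

lemma Carmichael_dvd_half_totient:
  assumes n: "n > 0" "n \<notin> cyclic_moduli"
  shows "Carmichael n dvd totient n div 2"
proof (cases "\<exists>k. n = 2 ^ k")
  case True
  then obtain k where k: "n = 2 ^ k" by blast
  have "k \<noteq> 0" "k \<noteq> 1" "k \<noteq> 2"
    using n by (auto simp: k cyclic_moduli_def)
  then have "k \<ge> 3" by linarith
  then obtain j where "k = j + 3"
    using le_Suc_ex by (metis add.commute)
  then show ?thesis
    by (simp add: k Carmichael_twopow totient_prime_power)
next
  case False
  then have "\<exists>p\<in>prime_factors n. p \<noteq> 2"
    using n Ex_other_prime_factor[of n 2] by auto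
  with n(1) obtain p k b where p: "p \<noteq> 2" "prime p" "\<not> p dvd b" "0 < k" "n = p ^ k * b"
    by (elim divide_out_primepow_ex[rotated]) auto
  have odd: "odd p"
    using p primes_dvd_imp_eq[of 2 p] by auto
  have "p > 2"
    using p prime_ge_2_nat[of p] by linarith
  then have "p ^ k > 2"
    using p(4) self_le_power[of p k] by simp
  moreover have "b \<noteq> 0" "b \<noteq> 1" "b \<noteq> 2"
    using n p odd by (auto simp: cyclic_moduli_def mult.commute)
  then have "b > 2" by linarith
  moreover have "coprime (p ^ k) b"
    using p prime_imp_coprime by auto
  ultimately show ?thesis
    using Carmichael_mult_coprime_dvd_half_totient p(5) by blast
qed

section \<open>Gauss's generalization of Wilson's theorem\<close>

theorem Gauss_Wilson:
  fixes n :: nat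
  assumes "n > 0"
  shows "[int (\<Prod>(totatives n)) = (if n \<in> cyclic_moduli then -1 else 1)] (mod int n)"
proof (cases "n > 2")
  case False
  \<comment> \<open>For \<open>n\<close> equal to 1 or 2 the product is 1, which agrees with -1
    modulo \<open>n\<close>.\<close>
  have "{0<..<2} = {1::nat}"
    by auto
  then have "totatives 2 = {1}"
    using totatives_prime[OF two_is_prime_nat] by simp
  moreover have "n = 1 \<or> n = 2"
    using False assms by linarith
  ultimately show ?thesis
    by (elim disjE) (simp_all add: cyclic_moduli_def cong_iff_dvd_diff)
next
  case n: True
  show ?thesis
  proof (cases "n \<in> cyclic_moduli")
    case True
    then obtain g where g: "residue_primroot n g"
      using residue_primroot_iff_in_cyclic_moduli by blast
    then have cop: "coprime g n"
      by (auto simp: residue_primroot_def coprime_commute)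
    have half: "[g ^ (totient n div 2) = n - 1] (mod n)"
      using primroot_power_half_totient[OF n g] .
    have "[\<Prod>(totatives n) = g ^ (totient n div 2)] (mod n)"
    \<comment> \<open>A primitive root is not a square: if it were \<open>a\<^sup>2\<close>, its
      power with exponent \<open>totient n div 2\<close> would be 1 by Euler's theorem, not
      -1.\<close>
    proof (rule prod_totatives_nonsquare[OF n cop])
      fix a assume a: "coprime a n"
      show "[a\<^sup>2 \<noteq> g] (mod n)"
      proof
        assume "[a\<^sup>2 = g] (mod n)"
        then have "[a ^ (2 * (totient n div 2)) = g ^ (totient n div 2)] (mod n)"
          unfolding power_mult by (rule cong_pow)
        then have "[1 = n - 1] (mod n)"
          using half totient_even[OF n] euler_theorem[OF a]
          by (metis cong_sym cong_trans dvd_mult_div_cancel)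
        then show False
          using n by (simp add: cong_def)
      qed
    qed
    then have "[int (\<Prod>(totatives n)) = int (n - 1)] (mod int n)"
      using half unfolding cong_int_iff by (rule cong_trans)
    also have "[int (n - 1) = -1] (mod int n)"
      using n by (simp add: cong_iff_dvd_diff of_nat_diff)
    finally show ?thesis using True by simp
  next
    case False
    obtain c where c: "coprime c n" "\<And>a. coprime a n \<Longrightarrow> [a\<^sup>2 \<noteq> c] (mod n)"
      using ex_coprime_nonsquare[OF n] by blast
    have "[c ^ (totient n div 2) = 1] (mod n)"
      using Carmichael_divides[OF Carmichael_dvd_half_totient] c assms False
      by (simp add: coprime_commute)
    then have "[\<Prod>(totatives n) = 1] (mod n)"
      using prod_totatives_nonsquare[OF n c] cong_trans by blast
    then show ?thesis
      using False by (metis cong_int_iff of_nat_1)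
  qed
qed

section \<open>Passage to integer moduli and arbitrary representatives\<close>

lemma prod_cong_prod_totatives:
  fixes m :: int and D :: "nat \<Rightarrow> int"
  assumes "m \<noteq> 0"
    and cop: "\<And>i. i \<in> {1..phi m} \<Longrightarrow> coprime (D i) m"
    and inj: "\<And>i j. i \<in> {1..phi m} \<Longrightarrow> j \<in> {1..phi m} \<Longrightarrow> [D i = D j] (mod m) \<Longrightarrow> i = j"
  shows "[(\<Prod>i=1..phi m. D i) = int (\<Prod>(totatives (nat \<bar>m\<bar>)))] (mod m)"
proof (cases "\<bar>m\<bar> = 1")
  \<comment> \<open>The least residue modulo 1 is 0, whereas \<open>totatives 1\<close> is
    \<open>{1}\<close>, so the bijection below needs a modulus above 1; here every congruence is
    trivial.\<close>
  case True
  then have "m dvd 1" by (metis abs_dvd_iff dvd_refl)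
  then show ?thesis
    by (meson cong_iff_dvd_diff dvd_trans one_dvd)
next
  case False
  define n where "n = nat \<bar>m\<bar>"
  have n: "n > 1" "\<bar>m\<bar> = int n"
    using False assms(1) by (auto simp: n_def)
  define h where "h i = nat (D i mod int n)" for i
  have int_h: "int (h i) = D i mod int n" for i
    using n by (simp add: h_def)
  have cong_h: "[int (h i) = D i] (mod m)" for i
    unfolding int_h by (metis cong_abs cong_mod_left cong_refl n(2))
  have "inj_on h {1..phi m}"
    using inj cong_h by (intro inj_onI) (metis cong_sym cong_trans)
  moreover have "h ` {1..phi m} \<subseteq> totatives n"
  proof
    fix a assume "a \<in> h ` {1..phi m}"
    then obtain i where i: "i \<in> {1..phi m}" "a = h i" by blast
    have "coprime (int (h i)) m"
      using cong_imp_coprime[OF cong_sym[OF cong_h] cop[OF i(1)]] .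
    then have "coprime (int (h i)) (int n)"
      using n(2) by (metis coprime_abs_right_iff)
    then have "coprime (h i) n"
      by simp
    moreover have "h i < n"
      using n int_h[of i] by (metis of_nat_less_iff pos_mod_bound of_nat_0_less_iff less_trans zero_less_one)
    ultimately show "a \<in> totatives n"
      using n i(2) by (auto simp: in_totatives_iff intro!: Nat.gr0I)
  qed
  \<comment> \<open>Counting turns the injection \<open>h\<close> into a bijection onto the
    totatives.\<close>
  moreover have "card (totatives n) = card {1..phi m}"
    by (simp add: phi_def n_def totient_def)
  ultimately have "h ` {1..phi m} = totatives n" "inj_on h {1..phi m}"
    using card_subset_eq[OF finite_totatives, of "h ` {1..phi m}" n] by (simp_all add: card_image)
  then have "\<Prod>(totatives n) = (\<Prod>i=1..phi m. h i)"
    using prod.reindex[of h "{1..phi m}" "\<lambda>a. a"] by simp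
  moreover have "[(\<Prod>i=1..phi m. D i) = (\<Prod>i=1..phi m. int (h i))] (mod m)"
    by (rule cong_prod) (rule cong_sym[OF cong_h])
  ultimately show ?thesis
    by (simp add: n_def)
qed

lemma nat_abs_in_cyclic_moduli_iff:
  fixes m :: int
  assumes "m \<noteq> 0"
  shows "nat \<bar>m\<bar> \<in> cyclic_moduli \<longleftrightarrow> m \<in> set_A"
proof
  assume "nat \<bar>m\<bar> \<in> cyclic_moduli"
  then consider "nat \<bar>m\<bar> = 2 ^ 0" | "nat \<bar>m\<bar> = 2 ^ 1" | "nat \<bar>m\<bar> = 2 ^ 2"
    | p k where "prime p" "odd p" "k > 0" "nat \<bar>m\<bar> = p ^ k"
    | p k where "prime p" "odd p" "k > 0" "nat \<bar>m\<bar> = 2 * p ^ k"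
    by (auto simp: cyclic_moduli_def)
  then show "m \<in> set_A"
  proof cases
    case (4 p k)
    then have "\<bar>m\<bar> = int p ^ k"
      by (metis abs_ge_zero nat_0_le of_nat_power)
    then have "m = int p ^ k \<or> m = - (int p ^ k)" by linarith
    moreover have "prime (int p)" "odd (int p)" "k \<ge> 1"
      using 4 by auto
    ultimately show ?thesis unfolding set_A_def by blast
  next
    case (5 p k)
    then have "\<bar>m\<bar> = 2 * int p ^ k"
      by (metis abs_ge_zero nat_0_le of_nat_power of_nat_mult of_nat_numeral)
    then have "m = 2 * int p ^ k \<or> m = - (2 * int p ^ k)" by linarith
    moreover have "prime (int p)" "odd (int p)" "k \<ge> 1"
      using 5 by auto
    ultimately show ?thesis unfolding set_A_def by blast
  qed (auto simp: set_A_def)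
next
  assume "m \<in> set_A"
  then consider k where "k \<in> {0, 1, 2::nat}" "m = 2 ^ k \<or> m = - (2 ^ k)"
    | p k where "prime p" "odd p" "k \<ge> 1"
        "m = p ^ k \<or> m = - (p ^ k) \<or> m = 2 * p ^ k \<or> m = - (2 * p ^ k)"
    using assms unfolding set_A_def by blast
  then show "nat \<bar>m\<bar> \<in> cyclic_moduli"
  proof cases
    case (2 p k)
    define q where "q = nat p"
    have p: "p = int q"
      using prime_ge_0_int[OF 2(1)] by (simp add: q_def)
    have "prime q" "odd q" "k > 0"
      using 2 by (auto simp: p)
    moreover have "nat \<bar>m\<bar> = q ^ k \<or> nat \<bar>m\<bar> = 2 * q ^ k"
      using 2(4) by (auto simp: p abs_mult nat_mult_distrib nat_power_eq)
    ultimately show ?thesis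
      unfolding cyclic_moduli_def by blast
  qed (auto simp: cyclic_moduli_def)
qed

section \<open>The shifted product\<close>

theorem theorem5p26:
  fixes m x \<epsilon> :: int and r t :: nat
    and p :: "nat \<Rightarrow> int" and \<alpha> :: "nat \<Rightarrow> nat"
    and \<iota> :: "nat \<Rightarrow> nat" and C :: "nat \<Rightarrow> int"
  assumes "m \<noteq> 0"
    and "\<epsilon> = 1 \<or> \<epsilon> = - 1"
    and "\<And>i. i \<in> {1..r} \<Longrightarrow> prime (p i)"
    and "inj_on p {1..r}"
    and "\<And>i. i \<in> {1..r} \<Longrightarrow> \<alpha> i \<ge> 1"
    and "m = \<epsilon> * (\<Prod>i=1..r. p i ^ \<alpha> i)"
    and "reduced_residue_system m C"
    and "inj_on \<iota> {1..t}"
    and "\<iota> ` {1..t} \<subseteq> {1..r}"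
    and "(\<lambda>s. p (\<iota> s)) ` {1..t} = {q. prime q \<and> q dvd x \<and> q dvd m}"
  shows "[(\<Prod>i=1..phi m. x + C i) = (if m \<in> set_A then - 1 else 1)]
           (mod (\<Prod>s=1..t. p (\<iota> s) ^ \<alpha> (\<iota> s)))"
proof -
  define d where "d = (\<Prod>s=1..t. p (\<iota> s) ^ \<alpha> (\<iota> s))"
  \<comment> \<open>The complementary factor of \<open>m\<close> up to sign, made of the prime
    powers whose primes do not divide \<open>x\<close>.\<close>
  define e where "e = (\<Prod>i\<in>{1..r} - \<iota> ` {1..t}. p i ^ \<alpha> i)"
  have d: "d = (\<Prod>i\<in>\<iota> ` {1..t}. p i ^ \<alpha> i)"
    unfolding d_def using prod.reindex[OF assms(8), of "\<lambda>i. p i ^ \<alpha> i"] by simp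
  have m: "m = \<epsilon> * (d * e)"
    using assms(6) prod.subset_diff[OF assms(9), of "\<lambda>i. p i ^ \<alpha> i"]
    by (simp add: d e_def mult.commute)
  have "coprime d e"
    unfolding d e_def
  proof (intro prod_coprime_left prod_coprime_right)
    fix i j assume ij: "i \<in> \<iota> ` {1..t}" "j \<in> {1..r} - \<iota> ` {1..t}"
    then have "i \<in> {1..r}" "j \<in> {1..r}" "i \<noteq> j"
      using assms(9) by auto
    then have "coprime (p i) (p j)"
      using assms(3,4) by (intro primes_coprime) (auto dest: inj_onD)
    then show "coprime (p i ^ \<alpha> i) (p j ^ \<alpha> j)" by simp
  qed
  then obtain y where y: "[y = x] (mod d)" "[y = 0] (mod e)"
    using binary_chinese_remainder_int by blast
  \<comment> \<open>A prime factor of \<open>d\<close> divides some \<open>p (\<iota> s)\<close>,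
    hence \<open>x\<close>, and \<open>y\<close> agrees with \<open>x\<close> modulo it; a prime
    factor of \<open>e\<close> divides \<open>y\<close> by the choice of \<open>y\<close>.\<close>
  have dvd_y: "q dvd y" if q: "prime q" "q dvd m" for q
  proof -
    have "q dvd d * e"
      using q(2) assms(2) m by auto
    then consider "q dvd d" | "q dvd e"
      using q(1) prime_dvd_mult_iff by blast
    then show ?thesis
    proof cases
      case 1
      then obtain s where s: "s \<in> {1..t}" "q dvd p (\<iota> s) ^ \<alpha> (\<iota> s)"
        using q(1) by (auto simp: d_def prime_dvd_prod_iff)
      then have "q dvd p (\<iota> s)"
        using q(1) prime_dvd_power by blast
      moreover have "p (\<iota> s) dvd x"
        using assms(10) s(1) by blast
      ultimately have "q dvd x" by (rule dvd_trans)
      then show ?thesis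
        using cong_dvd_iff[OF cong_dvd_modulus[OF y(1) 1]] by blast
    next
      case 2
      then show ?thesis using y(2) by (meson cong_0_iff dvd_trans)
    qed
  qed
  have C: "\<And>i. i \<in> {1..phi m} \<Longrightarrow> coprime (C i) m"
    "\<And>i j. i \<in> {1..phi m} \<Longrightarrow> j \<in> {1..phi m} \<Longrightarrow> [C i = C j] (mod m) \<Longrightarrow> i = j"
    using assms(7) unfolding reduced_residue_system_def by blast+
  have "d dvd m" using m by simp
  have "[(\<Prod>i=1..phi m. x + C i) = (\<Prod>i=1..phi m. y + C i)] (mod d)"
    using cong_sym[OF y(1)] by (intro cong_prod cong_add) auto
  also have "[(\<Prod>i=1..phi m. y + C i) = int (\<Prod>(totatives (nat \<bar>m\<bar>)))] (mod d)"
  proof (rule cong_dvd_modulus[OF prod_cong_prod_totatives \<open>d dvd m\<close>])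
    fix i assume i: "i \<in> {1..phi m}"
    show "coprime (y + C i) m"
    \<comment> \<open>A prime dividing both \<open>y + C i\<close> and \<open>m\<close> divides
      \<open>y\<close>, hence also \<open>C i\<close>, which is coprime to \<open>m\<close>.\<close>
    proof (rule ccontr)
      assume "\<not> coprime (y + C i) m"
      then have "\<not> is_unit (gcd (y + C i) m)" "gcd (y + C i) m \<noteq> 0"
        using assms(1) by (auto simp: coprime_iff_gcd_eq_1)
      then obtain q where "prime q" "q dvd gcd (y + C i) m"
        using prime_divisor_exists by blast
      then have q: "prime q" "q dvd y + C i" "q dvd m"
        by simp_all
      then have "q dvd C i"
        using dvd_y[OF q(1,3)] dvd_add_right_iff by blast
      then show False
        using q C(1)[OF i] by (meson coprime_common_divisor not_prime_unit)
    qed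
  next
    fix i j assume "i \<in> {1..phi m}" "j \<in> {1..phi m}" "[y + C i = y + C j] (mod m)"
    then show "i = j"
      using C(2) cong_add_lcancel by blast
  qed (fact assms(1))
  also have "[int (\<Prod>(totatives (nat \<bar>m\<bar>))) = (if m \<in> set_A then - 1 else 1)] (mod d)"
    using Gauss_Wilson[of "nat \<bar>m\<bar>"] assms(1) nat_abs_in_cyclic_moduli_iff[OF assms(1)] \<open>d dvd m\<close>
    by (auto intro: cong_dvd_modulus)
  finally show ?thesis
    unfolding d_def .
qed

end
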